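(* Let $t\ge 1$ be an integer and let $G$ be a finite graph without an induced matching of size $t$. Then $h(G)\le 10\,t^t\,\omega(G)^{3t-3}\log\omega(G)$.
   Context: For a graph $G$, $\omega(G)$ denotes its clique number, and $h(G)$ denotes the smallest size of a subset of $V(G)$ that intersects every maximum independent set of $G$ (an independent set of size $\alpha(G)$, the independence number). An induced matching of size $t$ in $G$ consists of vertices $a_1,b_1,\dots,a_t,b_t$ such that the subgraph of $G$ induced on $\{a_i,b_i\}_{i\in[t]}$ has edge set exactly $\{a_ib_i : i\in[t]\}$. $\log$ denotes the natural logarithm.
   Formalization: The graph is additionally assumed to have clique number at least 2; for an edgeless nonempty graph the bound is 0 (log 1 = 0) while h = 1, and for the empty graph h and log 0 are undefined. *)

theory Defs
  imports Complex_Main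
begin

text \<open>A finite simple graph: finite vertex set V, symmetric irreflexive adjacency E
  (only its restriction to V matters).\<close>
definition graph :: "'a set \<Rightarrow> ('a \<Rightarrow> 'a \<Rightarrow> bool) \<Rightarrow> bool" where
  "graph V E \<longleftrightarrow> finite V \<and> (\<forall>x y. E x y \<longrightarrow> E y x) \<and> (\<forall>x. \<not> E x x)"

definition clique :: "'a set \<Rightarrow> ('a \<Rightarrow> 'a \<Rightarrow> bool) \<Rightarrow> 'a set \<Rightarrow> bool" where
  "clique V E K \<longleftrightarrow> K \<subseteq> V \<and> (\<forall>x\<in>K. \<forall>y\<in>K. x \<noteq> y \<longrightarrow> E x y)"

definition indep_set :: "'a set \<Rightarrow> ('a \<Rightarrow> 'a \<Rightarrow> bool) \<Rightarrow> 'a set \<Rightarrow> bool" where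
  "indep_set V E I \<longleftrightarrow> I \<subseteq> V \<and> (\<forall>x\<in>I. \<forall>y\<in>I. \<not> E x y)"

definition clique_number :: "'a set \<Rightarrow> ('a \<Rightarrow> 'a \<Rightarrow> bool) \<Rightarrow> nat" where
  "clique_number V E = Max {card K | K. clique V E K}"

definition indep_number :: "'a set \<Rightarrow> ('a \<Rightarrow> 'a \<Rightarrow> bool) \<Rightarrow> nat" where
  "indep_number V E = Max {card I | I. indep_set V E I}"

definition max_indep_set :: "'a set \<Rightarrow> ('a \<Rightarrow> 'a \<Rightarrow> bool) \<Rightarrow> 'a set \<Rightarrow> bool" where
  "max_indep_set V E I \<longleftrightarrow> indep_set V E I \<and> card I = indep_number V E"

definition hitting_number :: "'a set \<Rightarrow> ('a \<Rightarrow> 'a \<Rightarrow> bool) \<Rightarrow> nat" where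
  "hitting_number V E = (LEAST k. \<exists>S. S \<subseteq> V \<and> card S = k \<and>
      (\<forall>I. max_indep_set V E I \<longrightarrow> S \<inter> I \<noteq> {}))"

definition has_induced_matching :: "'a set \<Rightarrow> ('a \<Rightarrow> 'a \<Rightarrow> bool) \<Rightarrow> nat \<Rightarrow> bool" where
  "has_induced_matching V E t \<longleftrightarrow> (\<exists>a b :: nat \<Rightarrow> 'a.
      (\<forall>i<t. a i \<in> V \<and> b i \<in> V) \<and>
      card (a ` {..<t} \<union> b ` {..<t}) = 2 * t \<and>
      (\<forall>u \<in> a ` {..<t} \<union> b ` {..<t}. \<forall>v \<in> a ` {..<t} \<union> b ` {..<t}.
          E u v \<longleftrightarrow> (\<exists>i<t. {u, v} = {a i, b i})))"

end

theory Submission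
  imports Defs "HOL-Library.FuncSet"
begin

text \<open>
  The maximum independent sets have large measure and small complexity, so a small random sample
  hits all of them. Measure: a graph without an induced matching of size \<open>t = s + 1\<close> satisfies
  \<open>|V| \<le> \<omega>^(2 s) \<alpha>\<close> (Wagon), so a maximum independent set contains a fraction at least
  \<open>\<omega>^(- 2 s)\<close> of the vertices. Complexity: let X be a minimal subset of T such that every maximum
  independent set containing X contains T. By minimality each x in X has a neighbour outside X
  that is adjacent to no other element of X; among these neighbours there is no independent set of
  size t, so Ramsey's argument gives \<open>|X| \<le> s \<omega>^s\<close>. Hence the traces of the maximum independent
  sets on a finite sample are determined by at most \<open>s \<omega>^s\<close> of its points, and the double sampling
  argument of Vapnik and Chervonenkis for \<open>\<epsilon>\<close>-nets applies.
\<close>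

section \<open>Double sampling: small hitting sets for set systems of low complexity\<close>

text \<open>In the double sampling argument \<open>\<sigma>\<close> is the set of positions at which sample and ghost sample are
  exchanged; P j and Q j say that the j-th point of the sample, respectively of the ghost sample,
  lies in a given set. At each of the at least k positions where P or Q holds, \<open>\<sigma>\<close> is forced.\<close>
lemma card_swaps_le:
  fixes P Q :: "nat \<Rightarrow> bool"
  shows "card {\<sigma>. \<sigma> \<subseteq> {..<m} \<and> (\<forall>j<m. \<not> (if j \<in> \<sigma> then Q j else P j)) \<and>
           k \<le> card {j. j < m \<and> (if j \<in> \<sigma> then P j else Q j)}} * 2 ^ k \<le> 2 ^ m"
    (is "card ?W * _ \<le> _")
proof (cases "?W = {}")
  case False
  define J where "J = {j. j < m \<and> (P j \<or> Q j)}"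
  have J: "J \<subseteq> {..<m}" "finite J"
    by (auto simp: J_def)
  from False obtain \<sigma> where "\<sigma> \<in> ?W"
    by blast
  then have "k \<le> card {j. j < m \<and> (if j \<in> \<sigma> then P j else Q j)}"
    by blast
  also have "\<dots> \<le> card J"
    by (rule card_mono) (auto simp: J_def split: if_splits)
  finally have kJ: "k \<le> card J" .
  have Jm: "card J \<le> m"
    using card_mono[OF _ J(1)] by simp
  have "inj_on (\<lambda>\<sigma>. \<sigma> - J) ?W"
  proof (rule inj_onI)
    fix \<sigma> \<tau> assume "\<sigma> \<in> ?W" "\<tau> \<in> ?W" and eq: "\<sigma> - J = \<tau> - J"
    then have "j \<in> \<sigma> \<longleftrightarrow> j \<in> \<tau>" if "j \<in> J" for j
      using that by (auto simp: J_def) metis+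
    with eq show "\<sigma> = \<tau>"
      by blast
  qed
  moreover have "(\<lambda>\<sigma>. \<sigma> - J) ` ?W \<subseteq> Pow ({..<m} - J)"
    by blast
  ultimately have "card ?W \<le> card (Pow ({..<m} - J))"
    by (intro card_inj_on_le) auto
  also have "\<dots> = 2 ^ (m - card J)"
    using J by (simp add: card_Pow card_Diff_subset)
  finally have "card ?W * 2 ^ k \<le> 2 ^ (m - card J) * 2 ^ card J"
    using kJ by (intro mult_mono power_increasing) auto
  also have "\<dots> = 2 ^ m"
    using Jm by (simp flip: power_add)
  finally show ?thesis .
next
  case True
  then show ?thesis
    unfolding True by simp
qed

text \<open>A reverse Markov inequality: since the number of hits never exceeds m, its mean already shows that
  a fraction 1/(2q) of all samples has at least k hits. Chebyshev's inequality is not needed,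
  because the loss of a factor q only enters the final bound through its logarithm.\<close>
lemma card_many_hits_ge:
  fixes V I :: "'a set"
  assumes V: "finite V" and I: "I \<subseteq> V" "card V \<le> q * card I"
    and m: "m > 0" "2 * q * k \<le> m"
  shows "card V ^ m \<le> 2 * q * card {T \<in> {..<m} \<rightarrow>\<^sub>E V. k \<le> card {j. j < m \<and> T j \<in> I}}"
    (is "_ \<le> 2 * q * card ?N")
proof -
  let ?\<Omega> = "{..<m} \<rightarrow>\<^sub>E V"
  have fin: "finite ?\<Omega>"
    using V by (simp add: finite_PiE)
  have hit: "card {T \<in> ?\<Omega>. T j \<in> I} = card I * card V ^ (m - 1)" if "j < m" for j
  proof -
    have "T \<in> ?\<Omega> \<and> T j \<in> I \<longleftrightarrow> T \<in> (\<Pi>\<^sub>E i\<in>{..<m}. if i = j then I else V)" for T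
      using that I unfolding PiE_iff by (metis lessThan_iff subsetD)
    then have "{T \<in> ?\<Omega>. T j \<in> I} = (\<Pi>\<^sub>E i\<in>{..<m}. if i = j then I else V)"
      by blast
    then have "card {T \<in> ?\<Omega>. T j \<in> I} = (\<Prod>i<m. if i = j then card I else card V)"
      by (simp add: card_PiE if_distrib)
    also have "\<dots> = card I * (\<Prod>i\<in>{..<m}-{j}. card V)"
      using that by (subst prod.remove[of _ j]) auto
    finally show ?thesis
      using that by simp
  qed
  have "m * (card I * card V ^ (m - 1)) = (\<Sum>j<m. card {T \<in> ?\<Omega>. T j \<in> I})"
    by (simp add: hit)
  also have "\<dots> = (\<Sum>j<m. \<Sum>T\<in>?\<Omega>. of_bool (T j \<in> I))"
    using fin by (simp add: Int_def)
  also have "\<dots> = (\<Sum>T\<in>?\<Omega>. card {j. j < m \<and> T j \<in> I})"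
    by (subst sum.swap) (simp add: Int_def)
  also have "\<dots> \<le> (\<Sum>T\<in>?\<Omega>. (if k \<le> card {j. j < m \<and> T j \<in> I} then m else 0) + k)"
  proof (rule sum_mono)
    fix T
    have "card {j. j < m \<and> T j \<in> I} \<le> card {..<m}"
      by (rule card_mono) auto
    then show "card {j. j < m \<and> T j \<in> I} \<le>
        (if k \<le> card {j. j < m \<and> T j \<in> I} then m else 0) + k"
      by auto
  qed
  also have "\<dots> = m * card ?N + k * card V ^ m"
    using fin by (simp add: sum.distrib sum.If_cases Int_def card_PiE mult.commute)
  finally have *: "m * (card I * card V ^ (m - 1)) \<le> m * card ?N + k * card V ^ m" .
  have "card V ^ m = card V * card V ^ (m - 1)"
    using m by (simp add: power_eq_if)
  then have "m * card V ^ m \<le> q * (m * (card I * card V ^ (m - 1)))"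
    using mult_right_mono[OF I(2), of "m * card V ^ (m - 1)"] by (simp add: mult_ac)
  also have "\<dots> \<le> q * (m * card ?N + k * card V ^ m)"
    using * by (rule mult_left_mono) simp
  \<comment> \<open>Since \<open>2 * q * k \<le> m\<close>, the term with \<open>k\<close> is at
    most one of the two copies of \<open>m * card V ^ m\<close> on the left and cancels against
    it.\<close>
  finally have "2 * (m * card V ^ m) \<le> m * (2 * q * card ?N) + (2 * q * k) * card V ^ m"
    by (simp add: algebra_simps)
  also have "\<dots> \<le> m * (2 * q * card ?N) + m * card V ^ m"
    using m by (intro add_mono mult_right_mono) auto
  finally have "m * card V ^ m \<le> m * (2 * q * card ?N)"
    by simp
  then show ?thesis
    using m by simp
qed

text \<open>Here \<open>S\<close> is the sample and \<open>T\<close> the ghost sample. Exchanging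
  them at a set of positions permutes all pairs, so bad pairs can be counted by averaging over the
  \<open>2 ^ m\<close> exchanges of each fixed pair. There \<open>compress\<close> leaves at most
  \<open>(2 * m) ^ d\<close> traces, and each of them is bad for at most a fraction
  \<open>1 / 2 ^ k\<close> of the exchanges.\<close>

lemma card_ghost_pairs_le:
  fixes V :: "'a set"
  assumes V: "finite V" and d: "d \<ge> 1" and k: "k \<ge> 1"
    and compress: "\<And>I T. I \<in> F \<Longrightarrow> T \<subseteq> I \<Longrightarrow>
          \<exists>X\<subseteq>T. card X \<le> d \<and> (\<forall>J\<in>F. X \<subseteq> J \<longrightarrow> T \<subseteq> J)"
  shows "card {(S, T). S \<in> {..<m} \<rightarrow>\<^sub>E V \<and> T \<in> {..<m} \<rightarrow>\<^sub>E V \<and>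
           (\<exists>I\<in>F. (\<forall>j<m. S j \<notin> I) \<and> k \<le> card {j. j < m \<and> T j \<in> I})} * 2 ^ k
         \<le> (2 * m) ^ d * card V ^ (2 * m)"
    (is "card ?B * _ \<le> _")
proof -
  let ?\<Omega> = "{..<m} \<rightarrow>\<^sub>E V"
  define bad :: "(nat \<Rightarrow> 'a) \<Rightarrow> (nat \<Rightarrow> 'a) \<Rightarrow> 'a set \<Rightarrow> bool" where
    "bad S T I \<longleftrightarrow> (\<forall>j<m. S j \<notin> I) \<and> k \<le> card {j. j < m \<and> T j \<in> I}" for S T I
  define sw :: "nat set \<Rightarrow> (nat \<Rightarrow> 'a) \<times> (nat \<Rightarrow> 'a) \<Rightarrow> (nat \<Rightarrow> 'a) \<times> (nat \<Rightarrow> 'a)" where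
    "sw \<sigma> = (\<lambda>(S, T). (\<lambda>j. if j \<in> \<sigma> then T j else S j, \<lambda>j. if j \<in> \<sigma> then S j else T j))" for \<sigma>
  have sw_sw: "sw \<sigma> (sw \<sigma> p) = p" for \<sigma> p
    by (cases p) (auto simp: sw_def)
  have sw_mem: "sw \<sigma> p \<in> ?\<Omega> \<times> ?\<Omega>" if "p \<in> ?\<Omega> \<times> ?\<Omega>" for \<sigma> p
    using that by (cases p) (auto simp: sw_def PiE_iff extensional_def)
  have fin: "finite (?\<Omega> \<times> ?\<Omega>)"
    using V by (simp add: finite_PiE)
  define B where "B = ?B"
  have B_iff: "p \<in> B \<longleftrightarrow> p \<in> ?\<Omega> \<times> ?\<Omega> \<and> (\<exists>I\<in>F. bad (fst p) (snd p) I)" for p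
    unfolding B_def bad_def by (cases p) (simp add: mem_Times_iff)
  have B: "B \<subseteq> ?\<Omega> \<times> ?\<Omega>"
    using B_iff by blast
  have cardB: "card {p \<in> ?\<Omega> \<times> ?\<Omega>. sw \<sigma> p \<in> B} = card B" for \<sigma>
  proof (rule bij_betw_same_card)
    show "bij_betw (sw \<sigma>) {p \<in> ?\<Omega> \<times> ?\<Omega>. sw \<sigma> p \<in> B} B"
    proof (rule bij_betw_byWitness[where f' = "sw \<sigma>"])
      show "sw \<sigma> ` B \<subseteq> {p \<in> ?\<Omega> \<times> ?\<Omega>. sw \<sigma> p \<in> B}"
        using B sw_mem by (intro image_subsetI CollectI conjI) (blast, simp add: sw_sw)
    qed (simp add: sw_sw, simp add: sw_sw, blast)
  qed
  \<comment> \<open>For a fixed pair, union bound over the sets cl X that have the same trace on the sample as some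
    member of F, where X runs over the (ranges of) lists of d sample points.\<close>
  have swaps: "card {\<sigma>. \<sigma> \<subseteq> {..<m} \<and> sw \<sigma> p \<in> B} * 2 ^ k \<le> (2 * m) ^ d * 2 ^ m"
    if "p \<in> ?\<Omega> \<times> ?\<Omega>" for p
  proof -
    obtain S T where p: "p = (S, T)"
      by fastforce
    define A where "A = S ` {..<m} \<union> T ` {..<m}"
    define cl where "cl X = \<Inter>{J \<in> F. X \<subseteq> J}" for X
    \<comment> \<open>Lists of length exactly \<open>d\<close>, repetitions allowed, make the count
      \<open>card A ^ d\<close> immediate.\<close>
    define L where "L = {xs. set xs \<subseteq> A \<and> length xs = d}"
    define W where "W C = {\<sigma>. \<sigma> \<subseteq> {..<m} \<and> bad (fst (sw \<sigma> p)) (snd (sw \<sigma> p)) C}" for C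
    have finA: "finite A"
      by (simp add: A_def)
    have "card A \<le> card (S ` {..<m}) + card (T ` {..<m})"
      unfolding A_def by (rule card_Un_le)
    also have "\<dots> \<le> m + m"
      by (intro add_mono) (use card_image_le[of "{..<m}"] in force)+
    finally have cardA: "card A \<le> 2 * m"
      by simp
    have finL: "finite L" and cardL: "card L \<le> (2 * m) ^ d"
      unfolding L_def using finA power_mono[OF cardA]
      by (simp_all only: finite_lists_length_eq card_lists_length_eq)
    have W_eq: "W C = {\<sigma>. \<sigma> \<subseteq> {..<m} \<and> (\<forall>j<m. \<not> (if j \<in> \<sigma> then T j \<in> C else S j \<in> C)) \<and>
        k \<le> card {j. j < m \<and> (if j \<in> \<sigma> then S j \<in> C else T j \<in> C)}}" for C
      unfolding W_def bad_def sw_def p by (intro Collect_cong arg_cong2[of _ _ _ _ "(\<and>)"] refl)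
         (simp_all split: if_splits)
    have cardW: "card (W C) * 2 ^ k \<le> 2 ^ m" for C
      unfolding W_eq by (rule card_swaps_le)
    have "{\<sigma>. \<sigma> \<subseteq> {..<m} \<and> sw \<sigma> p \<in> B} \<subseteq> (\<Union>xs\<in>L. W (cl (set xs)))"
    proof
      fix \<sigma> assume "\<sigma> \<in> {\<sigma>. \<sigma> \<subseteq> {..<m} \<and> sw \<sigma> p \<in> B}"
      then obtain I where \<sigma>: "\<sigma> \<subseteq> {..<m}" and I: "I \<in> F"
        and badI: "bad (fst (sw \<sigma> p)) (snd (sw \<sigma> p)) I"
        by (auto simp: B_iff)
      from compress[OF I, of "I \<inter> A"] obtain X where
        X: "X \<subseteq> I \<inter> A" "card X \<le> d" "\<forall>J\<in>F. X \<subseteq> J \<longrightarrow> I \<inter> A \<subseteq> J"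
        by auto
      have pts: "fst (sw \<sigma> p) j \<in> A \<and> snd (sw \<sigma> p) j \<in> A" if "j < m" for j
        using that by (auto simp: sw_def p A_def)
      have "{j. j < m \<and> snd (sw \<sigma> p) j \<in> I} \<noteq> {}"
        using badI k unfolding bad_def by (metis card.empty not_one_le_zero order_trans)
      then obtain x where x: "x \<in> I \<inter> A"
        using pts by auto
      \<comment> \<open>Padding to length \<open>d\<close> repeats the head of a list, so an empty
        \<open>X\<close> is replaced by a single point; \<open>k \<ge> 1\<close> provides one, as
        some ghost point lies in \<open>I\<close>.\<close>
      define X' where "X' = (if X = {} then {x} else X)"
      have X': "X' \<subseteq> I \<inter> A" "card X' \<le> d" "\<forall>J\<in>F. X' \<subseteq> J \<longrightarrow> I \<inter> A \<subseteq> J" "X' \<noteq> {}"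
        using X x d by (auto simp: X'_def)
      have "finite X'"
        using X' finA by (meson finite_subset le_infE)
      then obtain ys where ys: "set ys = X'" "distinct ys"
        using finite_distinct_list by blast
      then have len: "length ys \<le> d"
        using X'(2) distinct_card by metis
      have ne: "ys \<noteq> []"
        using ys X' by auto
      define xs where "xs = ys @ replicate (d - length ys) (hd ys)"
      have xs: "set xs = X'" "xs \<in> L"
        using ys len ne X' by (auto simp: xs_def L_def set_replicate_conv_if)
      \<comment> \<open>On one side \<open>I\<close> is among the sets intersected in
        \<open>cl X'\<close>; on the other, each of these sets contains
        \<open>I \<inter> A\<close>.\<close>
      have clI: "y \<in> cl X' \<longleftrightarrow> y \<in> I" if "y \<in> A" for y
        using that X' I unfolding cl_def by blast
      have "bad (fst (sw \<sigma> p)) (snd (sw \<sigma> p)) (cl X')"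
        using badI clI pts unfolding bad_def by (auto cong: conj_cong)
      then show "\<sigma> \<in> (\<Union>xs\<in>L. W (cl (set xs)))"
        using xs \<sigma> unfolding W_def by blast
    qed
    moreover have "finite (W C)" for C
      unfolding W_def by (rule finite_subset[of _ "Pow {..<m}"]) auto
    ultimately have "card {\<sigma>. \<sigma> \<subseteq> {..<m} \<and> sw \<sigma> p \<in> B} \<le> card (\<Union>xs\<in>L. W (cl (set xs)))"
      using finL by (intro card_mono) auto
    also have "\<dots> \<le> (\<Sum>xs\<in>L. card (W (cl (set xs))))"
      using finL by (rule card_UN_le)
    finally have "card {\<sigma>. \<sigma> \<subseteq> {..<m} \<and> sw \<sigma> p \<in> B} * 2 ^ k \<le>
        (\<Sum>xs\<in>L. card (W (cl (set xs))) * 2 ^ k)"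
      by (simp flip: sum_distrib_right)
    also have "\<dots> \<le> (\<Sum>xs\<in>L. 2 ^ m)"
      by (intro sum_mono cardW)
    also have "\<dots> \<le> (2 * m) ^ d * 2 ^ m"
      using cardL by simp
    finally show ?thesis .
  qed
  have cardV2: "card (?\<Omega> \<times> ?\<Omega>) = card V ^ (2 * m)"
    by (simp add: card_cartesian_product card_PiE mult_2 power_add)
  \<comment> \<open>Double counting of the \<open>\<sigma>\<close> and \<open>p\<close> with
    \<open>sw \<sigma> p\<close> in \<open>B\<close>: every \<open>\<sigma>\<close> accounts for
    exactly \<open>card B\<close> pairs.\<close>
  have "2 ^ m * card B = (\<Sum>\<sigma>\<in>Pow {..<m}. card {p \<in> ?\<Omega> \<times> ?\<Omega>. sw \<sigma> p \<in> B})"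
    unfolding cardB by (simp add: card_Pow)
  also have "\<dots> = (\<Sum>\<sigma>\<in>Pow {..<m}. \<Sum>p\<in>?\<Omega> \<times> ?\<Omega>. of_bool (sw \<sigma> p \<in> B))"
    using fin by (simp add: Int_def)
  also have "\<dots> = (\<Sum>p\<in>?\<Omega> \<times> ?\<Omega>. card {\<sigma>. \<sigma> \<subseteq> {..<m} \<and> sw \<sigma> p \<in> B})"
    by (subst sum.swap) (simp add: Int_def)
  finally have "2 ^ m * (card B * 2 ^ k) =
      (\<Sum>p\<in>?\<Omega> \<times> ?\<Omega>. card {\<sigma>. \<sigma> \<subseteq> {..<m} \<and> sw \<sigma> p \<in> B} * 2 ^ k)"
    by (simp flip: sum_distrib_right)
  also have "\<dots> \<le> (\<Sum>p\<in>?\<Omega> \<times> ?\<Omega>. (2 * m) ^ d * 2 ^ m)"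
    by (intro sum_mono swaps)
  also have "\<dots> = 2 ^ m * ((2 * m) ^ d * card V ^ (2 * m))"
    using cardV2 by (simp add: mult_ac)
  finally show ?thesis
    by (simp add: B_def)
qed

text \<open>If every sample \<open>S\<close> missed a member \<open>f S\<close> of \<open>F\<close>,
  then for each \<open>S\<close> at least a fraction \<open>1 / (2 * q)\<close> of the ghost samples
  would hit \<open>f S\<close> at least \<open>k\<close> times. That yields more bad pairs than the
  previous lemma permits under \<open>union_bound\<close>.\<close>

lemma hitting_set_of_compression:
  fixes V :: "'a set"
  assumes V: "finite V" "V \<noteq> {}" and F: "\<And>I. I \<in> F \<Longrightarrow> I \<subseteq> V" and d: "d \<ge> 1"
    and compress: "\<And>I T. I \<in> F \<Longrightarrow> T \<subseteq> I \<Longrightarrow>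
          \<exists>X\<subseteq>T. card X \<le> d \<and> (\<forall>J\<in>F. X \<subseteq> J \<longrightarrow> T \<subseteq> J)"
    and big: "\<And>I. I \<in> F \<Longrightarrow> card V \<le> q * card I"
    and m: "m > 0" "2 * q * k \<le> m" and k: "k \<ge> 1"
    and union_bound: "2 * q * (2 * m) ^ d < 2 ^ k"
  shows "\<exists>S\<subseteq>V. card S \<le> m \<and> (\<forall>I\<in>F. S \<inter> I \<noteq> {})"
proof (rule ccontr)
  assume no: "\<not> ?thesis"
  let ?\<Omega> = "{..<m} \<rightarrow>\<^sub>E V"
  let ?B = "{(S, T). S \<in> ?\<Omega> \<and> T \<in> ?\<Omega> \<and>
       (\<exists>I\<in>F. (\<forall>j<m. S j \<notin> I) \<and> k \<le> card {j. j < m \<and> T j \<in> I})}"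
  have fin: "finite ?\<Omega>"
    using V by (simp add: finite_PiE)
  have "\<exists>I\<in>F. \<forall>j<m. S j \<notin> I" if "S \<in> ?\<Omega>" for S
  proof -
    have "S ` {..<m} \<subseteq> V" "card (S ` {..<m}) \<le> m"
      using that card_image_le[of "{..<m}" S] by auto
    with no have "\<exists>I\<in>F. S ` {..<m} \<inter> I = {}"
      by meson
    then show ?thesis
      by (auto simp: disjoint_iff)
  qed
  then have "\<forall>S\<in>?\<Omega>. \<exists>I. I \<in> F \<and> (\<forall>j<m. S j \<notin> I)"
    by (intro ballI) (simp only: Bex_def)
  then obtain f where "\<forall>S\<in>?\<Omega>. f S \<in> F \<and> (\<forall>j<m. S j \<notin> f S)"
    by (rule bchoice[THEN exE])
  then have f: "f S \<in> F" "j < m \<Longrightarrow> S j \<notin> f S" if "S \<in> ?\<Omega>" for S j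
    using that by simp_all
  define N where "N S = {T \<in> ?\<Omega>. k \<le> card {j. j < m \<and> T j \<in> f S}}" for S
  have "card V ^ (2 * m) = (\<Sum>S\<in>?\<Omega>. card V ^ m)"
    by (simp add: card_PiE mult_2 power_add)
  also have "\<dots> \<le> (\<Sum>S\<in>?\<Omega>. 2 * q * card (N S))"
    unfolding N_def using f F big V m by (intro sum_mono card_many_hits_ge) auto
  also have "\<dots> = 2 * q * card (Sigma ?\<Omega> N)"
    using fin by (subst card_SigmaI) (auto simp: N_def sum_distrib_left)
  also have "\<dots> \<le> 2 * q * card ?B"
  proof (intro mult_left_mono card_mono)
    show "finite ?B"
      by (rule finite_subset[of _ "?\<Omega> \<times> ?\<Omega>"]) (use fin in auto)
    show "Sigma ?\<Omega> N \<subseteq> ?B"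
      using f by (auto simp: N_def intro!: bexI[where x = "f _"])
  qed auto
  finally have "card V ^ (2 * m) * 2 ^ k \<le> 2 * q * (card ?B * 2 ^ k)"
    by simp
  also have "\<dots> \<le> 2 * q * ((2 * m) ^ d * card V ^ (2 * m))"
    using card_ghost_pairs_le[OF V(1) d k compress] by (intro mult_left_mono) auto
  finally have "card V ^ (2 * m) * 2 ^ k \<le> card V ^ (2 * m) * (2 * q * (2 * m) ^ d)"
    by (simp add: mult_ac)
  moreover have "card V ^ (2 * m) > 0"
    using V by (simp add: card_gt_0_iff)
  ultimately show False
    using union_bound by (simp del: power_mult)
qed

section \<open>Maximum cliques and a Ramsey bound\<close>

lemma max_clique_exists:
  assumes "finite U"
  shows "\<exists>K. clique U E K \<and> (\<forall>K'. clique U E K' \<longrightarrow> card K' \<le> card K)"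
proof -
  have "clique U E {}"
    by (simp add: clique_def)
  moreover have "\<forall>K. clique U E K \<longrightarrow> card K < Suc (card U)"
    using assms by (auto simp: clique_def less_Suc_eq_le intro: card_mono)
  ultimately show ?thesis
    by (rule ex_has_greatest_nat)
qed

text \<open>Both the Ramsey bound and Wagon's bound use this to sort the vertices by their
  non-neighbours in a maximum clique.\<close>

lemma max_clique_nonneighbour:
  assumes U: "finite U" and E: "\<And>x y. E x y \<Longrightarrow> E y x"
    and K: "clique U E K" "\<And>K'. clique U E K' \<Longrightarrow> card K' \<le> card K"
    and x: "x \<in> U" "x \<notin> K"
  shows "\<exists>u\<in>K. \<not> E x u"
proof (rule ccontr)
  assume "\<not> ?thesis"
  then have "clique U E (insert x K)"
    using K(1) x E unfolding clique_def by blast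
  moreover have "finite K"
    using K(1) U unfolding clique_def by (metis finite_subset)
  ultimately show False
    using K(2)[of "insert x K"] x by simp
qed

text \<open>Every vertex lies in a maximum clique \<open>K\<close> or misses some \<open>u\<close>
  in \<open>K\<close>. The non-neighbours of \<open>u\<close> have smaller independent sets, because
  \<open>u\<close> can be added to each, so induction on \<open>s\<close> gives at most
  \<open>w * (1 + s * w ^ s)\<close> vertices.\<close>

lemma ramsey_card_le:
  fixes Y :: "'a set"
  assumes "finite Y" and E: "\<And>x y. E x y \<Longrightarrow> E y x" "\<And>x. \<not> E x x"
    and "\<And>K. clique Y E K \<Longrightarrow> card K \<le> w" "\<And>I. indep_set Y E I \<Longrightarrow> card I \<le> s"
  shows "card Y \<le> s * w ^ s"
  using assms(1,4,5)
proof (induction s arbitrary: Y)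
  case 0
  have "x \<notin> Y" for x
    using "0.prems"(3)[of "{x}"] E by (auto simp: indep_set_def)
  then show ?case
    by (metis card.empty equals0I le0)
next
  case (Suc s)
  obtain K where K: "clique Y E K" "\<And>K'. clique Y E K' \<Longrightarrow> card K' \<le> card K"
    using max_clique_exists[OF \<open>finite Y\<close>] by blast
  have finK: "finite K"
    using K(1) Suc.prems(1) unfolding clique_def by (metis finite_subset)
  define Z where "Z u = {x \<in> Y. x \<noteq> u \<and> \<not> E x u}" for u
  have cover: "Y \<subseteq> (\<Union>u\<in>K. insert u (Z u))"
    using max_clique_nonneighbour[where E = E, OF Suc.prems(1) E(1) K] unfolding Z_def by blast
  have Z: "card (Z u) \<le> s * w ^ s" if "u \<in> K" for u
  proof (rule Suc.IH)
    show "finite (Z u)"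
      using Suc.prems(1) by (simp add: Z_def)
    show "card L \<le> w" if "clique (Z u) E L" for L
      using that by (intro Suc.prems(2)) (auto simp: clique_def Z_def)
    show "card I \<le> s" if I: "indep_set (Z u) E I" for I
    proof -
      have "finite I"
        using I Suc.prems(1) by (auto simp: indep_set_def Z_def intro: finite_subset[of I Y])
      moreover have "u \<notin> I"
        using I by (auto simp: indep_set_def Z_def)
      moreover have "indep_set Y E (insert u I)"
      proof -
        have "u \<in> Y" and "I \<subseteq> Y" and "\<And>x. x \<in> I \<Longrightarrow> \<not> E x u" and "\<And>x y. x \<in> I \<Longrightarrow> y \<in> I \<Longrightarrow> \<not> E x y"
          using I \<open>u \<in> K\<close> K(1) by (auto simp: indep_set_def Z_def clique_def)
        then show ?thesis
          unfolding indep_set_def using E by (metis insert_iff insert_subset)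
      qed
      ultimately show ?thesis
        using Suc.prems(3)[of "insert u I"] by simp
    qed
  qed
  have "card Y \<le> card (\<Union>u\<in>K. insert u (Z u))"
    using cover finK Suc.prems(1) by (intro card_mono) (auto simp: Z_def)
  also have "\<dots> \<le> (\<Sum>u\<in>K. card (insert u (Z u)))"
    using finK by (rule card_UN_le)
  also have "\<dots> \<le> (\<Sum>u\<in>K. Suc (s * w ^ s))"
    using Z by (intro sum_mono order_trans[OF card_insert_le_m1[of "Suc _"]]) auto
  also have "\<dots> \<le> w * Suc (s * w ^ s)"
    using Suc.prems(2)[OF K(1)] by (simp only: sum_constant of_nat_id mult_le_mono1)
  also have "\<dots> \<le> Suc s * w ^ Suc s"
    using mult_le_mono2[of 1 "w ^ s" w] by (cases "w = 0") (simp_all add: algebra_simps)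
  finally show ?case .
qed

section \<open>Induced matchings and Wagon's bound on the number of vertices\<close>

lemma has_induced_matching_mono:
  fixes U V :: "'a set"
  assumes "has_induced_matching U E t" "U \<subseteq> V"
  shows "has_induced_matching V E t"
proof -
  obtain a b :: "nat \<Rightarrow> 'a" where "\<forall>i<t. a i \<in> U \<and> b i \<in> U"
    and *: "card (a ` {..<t} \<union> b ` {..<t}) = 2 * t"
      "\<forall>u\<in>a ` {..<t} \<union> b ` {..<t}. \<forall>v\<in>a ` {..<t} \<union> b ` {..<t}.
          E u v \<longleftrightarrow> (\<exists>i<t. {u, v} = {a i, b i})"
    using assms(1) unfolding has_induced_matching_def by (elim exE conjE)
  then have "\<forall>i<t. a i \<in> V \<and> b i \<in> V"
    using assms(2) by blast
  with * show ?thesis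
    unfolding has_induced_matching_def by (intro exI[of _ a] exI[of _ b] conjI)
qed

lemma has_induced_matching_one:
  assumes "E u v" "E v u" "\<not> E u u" "\<not> E v v" "u \<in> U" "v \<in> U"
  shows "has_induced_matching U E (Suc 0)"
  unfolding has_induced_matching_def using assms
  by (intro exI[of _ "\<lambda>_. u"] exI[of _ "\<lambda>_. v"])
     (auto simp: lessThan_Suc card_insert_if insert_commute doubleton_eq_iff)

text \<open>Used in contrapositive form: the part of a graph anticomplete to an edge has no induced
  matching of size one less, which drives the induction for Wagon's bound.\<close>

lemma has_induced_matching_Suc:
  fixes U :: "'a set"
  assumes M: "has_induced_matching U E t" and E: "\<And>x y. E x y \<Longrightarrow> E y x" "\<And>x. \<not> E x x"
    and uv: "E u v" "\<And>x. x \<in> U \<Longrightarrow> \<not> E x u \<and> \<not> E x v"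
  shows "has_induced_matching (insert u (insert v U)) E (Suc t)"
proof -
  obtain a b :: "nat \<Rightarrow> 'a" where ab: "\<forall>i<t. a i \<in> U \<and> b i \<in> U"
    and card: "card (a ` {..<t} \<union> b ` {..<t}) = 2 * t"
    and iff: "\<forall>x\<in>a ` {..<t} \<union> b ` {..<t}. \<forall>y\<in>a ` {..<t} \<union> b ` {..<t}.
          E x y \<longleftrightarrow> (\<exists>i<t. {x, y} = {a i, b i})"
    using M unfolding has_induced_matching_def by (elim exE conjE)
  let ?a = "a(t := u)" and ?b = "b(t := v)"
  define M where "M = a ` {..<t} \<union> b ` {..<t}"
  have MU: "M \<subseteq> U" and finM: "finite M"
    using ab by (auto simp: M_def)
  have un: "?a ` {..<Suc t} \<union> ?b ` {..<Suc t} = insert u (insert v M)"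
    by (auto simp: M_def lessThan_Suc)
  have nM: "u \<notin> M" "v \<notin> M" "u \<noteq> v"
    using uv MU E by blast+
  have ex_Suc: "(\<exists>i<Suc t. {x, y} = {?a i, ?b i}) \<longleftrightarrow> {x, y} = {u, v} \<or> (\<exists>i<t. {x, y} = {a i, b i})" for x y
    by (auto simp: less_Suc_eq)
  have *: "E x y \<longleftrightarrow> (\<exists>i<Suc t. {x, y} = {?a i, ?b i})"
    if x: "x \<in> insert u (insert v M)" and y: "y \<in> insert u (insert v M)" for x y
  proof -
    have in_M: "x \<in> M \<and> y \<in> M" if "i < t" "{x, y} = {a i, b i}" for i
      using that by (auto simp: M_def doubleton_eq_iff)
    show ?thesis
    proof (cases "x \<in> M \<and> y \<in> M")
      case True
      then show ?thesis
        using iff nM unfolding ex_Suc M_def[symmetric] by (auto simp: doubleton_eq_iff)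
    next
      case False
      then have "\<not> (\<exists>i<t. {x, y} = {a i, b i})"
        using in_M by blast
      then have r: "(\<exists>i<Suc t. {x, y} = {?a i, ?b i}) \<longleftrightarrow> {x, y} = {u, v}"
        unfolding ex_Suc by (simp only: simp_thms)
      have "\<not> E z u" "\<not> E z v" "\<not> E u z" "\<not> E v z" if "z \<in> M" for z
        using that uv(2) MU E(1) by blast+
      then have "E x y \<longleftrightarrow> {x, y} = {u, v}"
        using x y False uv(1) E(1)[OF uv(1)] E(2) nM(3) by (auto simp: doubleton_eq_iff)
      with r show ?thesis by simp
    qed
  qed
  have "\<forall>i<Suc t. ?a i \<in> insert u (insert v U) \<and> ?b i \<in> insert u (insert v U)"
    using ab by (simp add: less_Suc_eq)
  moreover have "card (insert u (insert v M)) = 2 * Suc t"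
    using card nM finM unfolding M_def[symmetric] by simp
  ultimately show ?thesis
    unfolding has_induced_matching_def using * un by (intro exI[of _ ?a] exI[of _ ?b]) simp
qed

text \<open>Following Wagon: for a maximum clique K, a vertex with two non-neighbours u, v in K lies in
  the part of the graph anticomplete to the edge u v, which has no induced matching of size
  one less; the vertices whose only non-neighbour in K is u form an independent set.\<close>
lemma card_le_indep_mult_clique:
  fixes U :: "'a set"
  assumes "finite U" and E: "\<And>x y. E x y \<Longrightarrow> E y x" "\<And>x. \<not> E x x"
    and "\<not> has_induced_matching U E (Suc s)"
    and "\<And>K. clique U E K \<Longrightarrow> card K \<le> w" "\<And>I. indep_set U E I \<Longrightarrow> card I \<le> a"
  shows "card U \<le> w ^ (2 * s) * a"
  using assms(1,4-6)
proof (induction s arbitrary: U)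
  case 0
  have "indep_set U E U"
    using "0.prems"(2) E has_induced_matching_one[of E _ _ U] unfolding indep_set_def by blast
  with "0.prems"(4) show ?case
    by simp
next
  case (Suc s)
  obtain K where K: "clique U E K" "\<And>K'. clique U E K' \<Longrightarrow> card K' \<le> card K"
    using max_clique_exists[OF \<open>finite U\<close>] by blast
  have KU: "K \<subseteq> U" and finK: "finite K"
    using K(1) Suc.prems(1) unfolding clique_def by (auto intro: finite_subset)
  have Kw: "card K \<le> w"
    using Suc.prems(3) K(1) .
  \<comment> \<open>The diagonal pairs serve vertices with exactly one non-neighbour in
    \<open>K\<close>, the other pairs those with at least two. There are at most
    \<open>w * w\<close> pairs, hence the factor \<open>w ^ 2\<close> per induction step.\<close>
  define A where "A = (\<lambda>(u, v). if u = v then {x \<in> U. {y \<in> K. \<not> E x y} = {u}}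
      else {x \<in> U. \<not> E x u \<and> \<not> E x v})"
  have finA: "finite (A p)" for p
    using Suc.prems(1) by (cases p) (simp add: A_def)
  have cover: "U \<subseteq> (\<Union>p\<in>K \<times> K. A p)"
  proof
    fix x assume x: "x \<in> U"
    \<comment> \<open>A vertex of \<open>K\<close> is its own non-neighbour, by
      irreflexivity.\<close>
    then obtain u where u: "u \<in> K" "\<not> E x u"
      using max_clique_nonneighbour[where E = E, OF Suc.prems(1) E(1) K] E(2) by blast
    show "x \<in> (\<Union>p\<in>K \<times> K. A p)"
    proof (cases "{y \<in> K. \<not> E x y} = {u}")
      case True
      with x u have "x \<in> A (u, u)"
        by (simp add: A_def)
      with u show ?thesis by blast
    next
      case False
      with u obtain v where "v \<in> K" "\<not> E x v" "u \<noteq> v"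
        by blast
      with x u have "x \<in> A (u, v)"
        by (simp add: A_def)
      with u \<open>v \<in> K\<close> show ?thesis by blast
    qed
  qed
  have A: "card (A (u, v)) \<le> w ^ (2 * s) * a" if uv: "u \<in> K" "v \<in> K" for u v
  proof (cases "u = v")
    case True
    have "indep_set U E (A (u, u))"
      unfolding indep_set_def
    proof (intro conjI ballI notI)
      show "A (u, u) \<subseteq> U"
        by (auto simp: A_def)
      fix x y assume "x \<in> A (u, u)" "y \<in> A (u, u)" and xy: "E x y"
      then have x: "x \<in> U" "{z \<in> K. \<not> E x z} = {u}" and y: "y \<in> U" "{z \<in> K. \<not> E y z} = {u}"
        by (simp_all add: A_def)
      have nK: "x \<notin> K - {u}" "y \<notin> K - {u}" "x \<noteq> y"
        using x y xy E(2) by blast+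
      \<comment> \<open>Adjacent \<open>x\<close> and \<open>y\<close> whose only non-neighbour in
        \<open>K\<close> is \<open>u\<close> could replace \<open>u\<close> and enlarge the maximum
        clique.\<close>
      have "clique U E (insert x (insert y (K - {u})))"
        unfolding clique_def using K(1)[unfolded clique_def] x y xy E(1) by blast
      then have "card (insert x (insert y (K - {u}))) \<le> card K"
        by (rule K(2))
      moreover have "card (insert x (insert y (K - {u}))) = Suc (card K)"
        proof -
        have "card (insert x (insert y (K - {u}))) = Suc (Suc (card (K - {u})))"
          using nK finK by (simp del: card_Diff_singleton card_Diff_insert)
        then show ?thesis
          using card_Suc_Diff1[OF finK uv(1)] by (simp only:)
      qed
      ultimately show False by simp
    qed
    then have "card (A (u, u)) \<le> a"
      by (rule Suc.prems(4))
    moreover have "w \<ge> 1"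
      using Kw uv finK by (metis card_gt_0_iff empty_iff One_nat_def Suc_le_eq order_less_le_trans)
    ultimately show ?thesis
      using True by (metis mult_le_mono nat_mult_1 one_le_power)
  next
    case False
    with uv K(1) have Euv: "E u v"
      by (auto simp: clique_def)
    have sub: "insert u (insert v (A (u, v))) \<subseteq> U"
      using uv KU False by (auto simp: A_def)
    show ?thesis
    proof (rule Suc.IH)
      show "finite (A (u, v))"
        by (rule finA)
      have "\<not> E x u \<and> \<not> E x v" if "x \<in> A (u, v)" for x
        using that False by (simp add: A_def)
      then show "\<not> has_induced_matching (A (u, v)) E (Suc s)"
        using has_induced_matching_Suc[where E = E, OF _ E Euv] has_induced_matching_mono[OF _ sub] Suc.prems(2)
        by blast
      show "card L \<le> w" if "clique (A (u, v)) E L" for L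
        using that sub by (intro Suc.prems(3)) (auto simp: clique_def)
      show "card I \<le> a" if "indep_set (A (u, v)) E I" for I
        using that sub by (intro Suc.prems(4)) (auto simp: indep_set_def)
    qed
  qed
  have "card U \<le> card (\<Union>p\<in>K \<times> K. A p)"
    using cover finK finA by (intro card_mono) auto
  also have "\<dots> \<le> (\<Sum>p\<in>K \<times> K. card (A p))"
    using finK by (intro card_UN_le) simp
  also have "\<dots> \<le> (\<Sum>p\<in>K \<times> K. w ^ (2 * s) * a)"
    using A by (intro sum_mono) auto
  also have "\<dots> = (card K * card K) * (w ^ (2 * s) * a)"
    by (simp add: card_cartesian_product)
  also have "\<dots> \<le> (w * w) * (w ^ (2 * s) * a)"
    using Kw by (intro mult_right_mono mult_mono) auto
  finally show ?case
    by (simp add: mult_ac)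
qed

section \<open>Traces of maximum independent sets are determined by few points\<close>

text \<open>Supplies the hypothesis \<open>compress\<close> of the sampling argument with
  \<open>d = s * w ^ s\<close>.\<close>

lemma max_indep_set_compression:
  fixes V :: "'a set"
  assumes V: "finite V" and E: "\<And>x y. E x y \<Longrightarrow> E y x" "\<And>x. \<not> E x x"
    and nM: "\<not> has_induced_matching V E (Suc s)"
    and w: "\<And>K. clique V E K \<Longrightarrow> card K \<le> w"
    and max: "\<And>I J. I \<in> F \<Longrightarrow> indep_set V E J \<Longrightarrow> card J \<le> card I"
    and F: "\<And>I. I \<in> F \<Longrightarrow> indep_set V E I"
    and I: "I \<in> F" and T: "T \<subseteq> I"
  shows "\<exists>X\<subseteq>T. card X \<le> s * w ^ s \<and> (\<forall>J\<in>F. X \<subseteq> J \<longrightarrow> T \<subseteq> J)"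
proof -
  define P where "P X \<longleftrightarrow> X \<subseteq> T \<and> (\<forall>J\<in>F. X \<subseteq> J \<longrightarrow> T \<subseteq> J)" for X
  have "P T"
    by (simp add: P_def)
  then obtain X where X: "P X" and least: "\<And>X'. P X' \<Longrightarrow> card X \<le> card X'"
    using ex_has_least_nat[of P T card] by blast
  have XT: "X \<subseteq> T" and XI: "X \<subseteq> I" and XV: "X \<subseteq> V"
    using X T F[OF I] by (auto simp: P_def indep_set_def)
  have finX: "finite X"
    using XV V finite_subset by blast
  have Xind: "\<not> E x x'" if "x \<in> X" "x' \<in> X" for x x'
    using that XI F[OF I] by (auto simp: indep_set_def)
  \<comment> \<open>Some \<open>J\<close> in \<open>F\<close> contains \<open>X - {x}\<close> but
    not \<open>T\<close>, hence misses \<open>x\<close>. As \<open>J\<close> is maximum,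
    \<open>x\<close> has a neighbour \<open>y\<close> in \<open>J\<close>; as \<open>J\<close> is
    independent, \<open>y\<close> has no neighbour in \<open>X - {x}\<close>.\<close>
  have "\<exists>y. y \<in> V \<and> E x y \<and> (\<forall>x'\<in>X - {x}. \<not> E x' y)" if x: "x \<in> X" for x
  proof -
    have "\<not> P (X - {x})"
      using least[of "X - {x}"] x finX by (metis card_Diff1_less not_less)
    then obtain J where J: "J \<in> F" "X - {x} \<subseteq> J" "\<not> T \<subseteq> J"
      using XT unfolding P_def by blast
    have xJ: "x \<notin> J"
      using X J by (auto simp: P_def)
    have finJ: "finite J"
      using F[OF J(1)] V unfolding indep_set_def by (metis finite_subset)
    have "\<not> indep_set V E (insert x J)"
      using max[OF J(1), of "insert x J"] xJ finJ by auto
    then obtain y where "y \<in> J" "E x y"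
      using F[OF J(1)] E x XV unfolding indep_set_def by blast
    then show ?thesis
      using J(2) F[OF J(1)] unfolding indep_set_def by blast
  qed
  then obtain f where f: "\<And>x. x \<in> X \<Longrightarrow> f x \<in> V" "\<And>x. x \<in> X \<Longrightarrow> E x (f x)"
      "\<And>x x'. x \<in> X \<Longrightarrow> x' \<in> X \<Longrightarrow> E x' (f x) \<Longrightarrow> x' = x"
    by (metis Diff_iff singletonD)
  have inj: "inj_on f X"
    using f(2,3) by (metis inj_onI)
  have "card (f ` X) \<le> s * w ^ s"
  proof (rule ramsey_card_le[where E = E, OF _ E])
    show "finite (f ` X)"
      using finX by simp
    show "card K \<le> w" if "clique (f ` X) E K" for K
      using that f(1) by (intro w) (auto simp: clique_def)
    \<comment> \<open>From \<open>s + 1\<close> pairwise nonadjacent private neighbours and their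
      owners in \<open>X\<close> an induced matching of size \<open>s + 1\<close> would arise: the
      owners are nonadjacent because they lie in \<open>I\<close>, and privacy leaves only the
      matching edges between the two sides.\<close>
    show "card Z \<le> s" if Z: "indep_set (f ` X) E Z" for Z
    proof (rule ccontr)
      assume "\<not> card Z \<le> s"
      then obtain Z' where Z': "Z' \<subseteq> Z" "card Z' = Suc s"
        using obtain_subset_with_card_n by (metis not_less_eq_eq)
      then have finZ': "finite Z'"
        using card.infinite by fastforce
      define W where "W = {x \<in> X. f x \<in> Z'}"
      have fW: "f ` W = Z'"
        using Z Z'(1) by (auto simp: W_def indep_set_def)
      have WX: "W \<subseteq> X" and finW: "finite W"
        using finX by (auto simp: W_def)
      have cW: "card W = Suc s"
        using fW Z'(2) inj WX by (metis card_image inj_on_subset)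
      then obtain g where g: "bij_betw g {..<Suc s} W"
        using finW by (metis ex_bij_betw_nat_finite atLeast0LessThan)
      have gW: "g ` {..<Suc s} = W" "(f \<circ> g) ` {..<Suc s} = Z'"
        using g fW by (auto simp: bij_betw_def image_comp[symmetric])
      have disj: "W \<inter> Z' = {}"
        using fW WX f(2) Xind by blast
      have Zind: "\<not> E y y'" if "y \<in> Z'" "y' \<in> Z'" for y y'
        using that Z Z'(1) by (auto simp: indep_set_def)
      have eW: "E u v \<longleftrightarrow> v = f u" if "u \<in> W" "v \<in> Z'" for u v
        using that fW WX f(2,3) by blast
      have ex: "(\<exists>i<Suc s. {u, v} = {g i, (f \<circ> g) i}) \<longleftrightarrow> (\<exists>x\<in>W. {u, v} = {x, f x})" for u v
        unfolding gW(1)[symmetric] by auto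
      have "E u v \<longleftrightarrow> (\<exists>x\<in>W. {u, v} = {x, f x})" if "u \<in> W \<union> Z'" "v \<in> W \<union> Z'" for u v
      proof (cases "u \<in> W")
        case u: True
        show ?thesis
        proof (cases "v \<in> W")
          case True
          then show ?thesis
            using u Xind WX disj fW by (auto simp: doubleton_eq_iff)
        next
          case False
          then show ?thesis
            using that u eW disj fW by (auto simp: doubleton_eq_iff)
        qed
      next
        case u: False
        show ?thesis
        proof (cases "v \<in> W")
          case True
          then have "E u v \<longleftrightarrow> u = f v"
            using that u eW E(1) by blast
          then show ?thesis
            using that u True by (auto simp: doubleton_eq_iff)
        next
          case False
          then show ?thesis
            using that u Zind by (auto simp: doubleton_eq_iff)
        qed
      qed
      moreover have "card (W \<union> Z') = 2 * Suc s"
        using disj finW finZ' cW Z'(2) by (simp add: card_Un_disjoint)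
      moreover have "\<forall>i<Suc s. g i \<in> V \<and> (f \<circ> g) i \<in> V"
        using gW(1) WX XV f(1) by auto
      ultimately have "has_induced_matching V E (Suc s)"
        unfolding has_induced_matching_def
        by (intro exI[of _ g] exI[of _ "f \<circ> g"]) (simp only: gW ex, blast)
      with nM show False ..
    qed
  qed
  then have "card X \<le> s * w ^ s"
    using card_image[OF inj] by simp
  with X show ?thesis
    by (auto simp: P_def)
qed

section \<open>The numerical estimate for the sample size\<close>

text \<open>After taking logarithms both sides have order \<open>u * l\<close> up to factors in
  \<open>s\<close>: the right side is about \<open>5 * ln 2 * t ^ Suc s * u * l\<close>, and the
  main term \<open>d * ln (2 * m)\<close> on the left is at most \<open>u * l\<close> times a cubic
  polynomial in \<open>s\<close>, which \<open>3 * t ^ Suc s\<close> dominates.\<close>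

lemma sample_size_suffices:
  fixes w s :: nat
  assumes w: "w \<ge> 2" and s: "s \<ge> 1"
  defines "m \<equiv> nat \<lfloor>10 * real (Suc s) ^ Suc s * real w ^ (3 * s) * ln (real w)\<rfloor>"
  shows "m > 0" "2 * w ^ (2 * s) * (2 * m) ^ (s * w ^ s) < 2 ^ (m div (2 * w ^ (2 * s)))"
proof -
  define l u t where "l = ln (real w)" and "u = real w ^ s" and "t = real (Suc s)"
  define x where "x = 10 * t ^ Suc s * u ^ 3 * l"
  define d where "d = s * w ^ s"
  define k where "k = m div (2 * w ^ (2 * s))"
  have m_def': "m = nat \<lfloor>x\<rfloor>"
    by (simp add: m_def x_def t_def u_def l_def mult.commute flip: power_mult)
  have l2: "l \<ge> ln 2"
    using w by (simp add: l_def)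
  \<comment> \<open>The bound \<open>3 / 5 \<le> ln 2\<close> is chosen to give
    \<open>3 \<le> 5 * ln 2\<close> in the last comparison.\<close>
  have "exp (3/5 :: real) ^ 5 = exp 1 ^ 3"
    by (simp flip: exp_of_nat_mult)
  also have "\<dots> \<le> 3 ^ 3"
    by (intro power_mono exp_le) simp
  also have "\<dots> \<le> 2 ^ 5"
    by simp
  finally have "exp (3/5 :: real) \<le> 2"
    by (rule power_le_imp_le_base[where n = 4, simplified]) simp
  moreover have "(2 :: real) \<le> exp (3/4)"
    using exp_lower_Taylor_quadratic[of "3/4 :: real"] by (simp add: power2_eq_square)
  ultimately have ln2: "3/5 \<le> (ln 2 :: real)" "(ln 2 :: real) \<le> 3/4"
    using ln_ge_iff[of "2 :: real" "3/5"] ln_mono[of "2 :: real" "exp (3/4)"] by simp_all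
  have l0: "l > 0"
    using l2 ln2 by linarith
  have t: "t \<ge> 2"
    using s by (simp add: t_def)
  have u2: "u \<ge> 2"
  proof -
    have "real w ^ 1 \<le> u"
      unfolding u_def using s w by (intro power_increasing) auto
    with w show ?thesis by simp
  qed
  have "1 * 1 \<le> t ^ Suc s * u ^ 3"
    using t u2 by (intro mult_mono one_le_power) auto
  then have "(1 :: real) * l \<le> (t ^ Suc s * u ^ 3) * l"
    using l0 by (intro mult_right_mono) auto
  then have x1: "x > 2"
    unfolding x_def mult.assoc using l2 ln2 by linarith
  then have m_le: "real m \<le> x" and m_gt: "real m > x - 1"
    unfolding m_def' by linarith+
  show m0: "m > 0"
    using m_gt x1 by (cases m) auto
  have "real k = of_int \<lfloor>real m / real (2 * w ^ (2 * s))\<rfloor>"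
    by (simp add: k_def floor_divide_of_nat_eq del: of_nat_mult)
  moreover have "real (2 * w ^ (2 * s)) = 2 * u\<^sup>2"
    by (simp add: u_def mult.commute flip: power_mult)
  ultimately have "real k > real m / (2 * u\<^sup>2) - 1"
    by simp
  moreover have "real m / (2 * u\<^sup>2) \<ge> (x - 1) / (2 * u\<^sup>2)"
    using m_gt by (intro divide_right_mono) auto
  moreover have "(x - 1) / (2 * u\<^sup>2) = 5 * t ^ Suc s * u * l - 1 / (2 * u\<^sup>2)"
    using u2 by (simp add: x_def field_simps power2_eq_square power3_eq_cube)
  moreover have "1 / (2 * u\<^sup>2) \<le> 1 / 2"
    using u2 by (simp add: field_simps)
  \<comment> \<open>The loss \<open>3 / 2\<close> consists of 1 from the division in
    \<open>k\<close> and at most \<open>1 / 2\<close> from rounding \<open>x\<close> down to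
    \<open>m\<close>.\<close>
  ultimately have k_gt: "real k > 5 * t ^ Suc s * u * l - 3 / 2"
    by linarith
  have "Suc s \<le> 2 ^ s"
    by (rule Suc_leI[OF less_exp])
  then have "t \<le> 2 ^ s"
    unfolding t_def by (metis of_nat_le_iff of_nat_numeral of_nat_power)
  then have "ln t \<le> ln (2 ^ s)"
    using t by simp
  also have "\<dots> \<le> s * l"
    using l2 by (simp add: ln_realpow mult_left_mono)
  finally have ln_t: "ln t \<le> s * l" .
  have "ln 20 \<le> ln (2 ^ 5 :: real)"
    by simp
  also have "\<dots> \<le> 5 * l"
    using l2 by (subst ln_realpow) auto
  finally have ln_20: "ln 20 \<le> 5 * l" .
  have "ln (2 * x) = ln 20 + t * ln t + 3 * ln u + ln l"
    using l0 t u2 by (simp add: x_def ln_mult ln_realpow t_def[symmetric] del: power_Suc of_nat_Suc)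
  \<comment> \<open>The \<open>- 1\<close> from \<open>ln l \<le> l - 1\<close> is kept: multiplied
    by \<open>d\<close> it becomes \<open>- s * u\<close>, which pays for the rounding
    losses.\<close>
  also have "\<dots> \<le> 5 * l + t * (s * l) + 3 * (s * l) + (l - 1)"
    using ln_20 ln_t t l0 ln_le_minus_one[of l] w
    by (intro add_mono mult_left_mono) (auto simp: u_def ln_realpow l_def)
  also have "\<dots> = l * (s\<^sup>2 + 4 * s + 6) - 1"
    by (simp add: t_def algebra_simps power2_eq_square)
  finally have ln_2x: "ln (2 * x) \<le> l * (s\<^sup>2 + 4 * s + 6) - 1" .
  have "ln (real (2 * w ^ (2 * s) * (2 * m) ^ d)) = ln 2 + 2 * s * l + d * ln (2 * m)"
    using w m0 by (simp add: ln_mult ln_realpow l_def distrib_left)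
  also have "\<dots> \<le> ln 2 + u * l + s * u * (l * (s\<^sup>2 + 4 * s + 6) - 1)"
  proof (intro add_mono order_refl)
    have "2 * s \<le> 2 ^ s"
      using s by (induction s rule: dec_induct) auto
    also have "\<dots> \<le> w ^ s"
      using w by (intro power_mono) auto
    finally have "real (2 * s) \<le> u"
      unfolding u_def by (metis of_nat_le_iff of_nat_power)
    then show "2 * s * l \<le> u * l"
      using l0 by (intro mult_right_mono) auto
    have "ln (2 * m) \<le> ln (2 * x)"
      using m_le m0 by (subst ln_le_cancel_iff) auto
    with ln_2x m0 show "d * ln (2 * m) \<le> s * u * (l * (s\<^sup>2 + 4 * s + 6) - 1)"
      unfolding d_def u_def by (intro mult_mono) auto
  qed
  also have "\<dots> = ln 2 + (u * l) * (1 + s * (s\<^sup>2 + 4 * s + 6)) - s * u"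
    by (simp add: algebra_simps)
  also have "\<dots> \<le> ln 2 + (u * l) * (3 * t ^ Suc s) - s * u"
  proof -
    have "1 + s * (s\<^sup>2 + 4 * s + 6) \<le> 3 * t ^ Suc s"
    \<comment> \<open>For \<open>s = 1\<close> both sides equal 12; the comparison through
      \<open>t ^ 3\<close> requires \<open>s \<ge> 2\<close>.\<close>
    proof (cases "s = 1")
      case False
      have "1 + s * (s\<^sup>2 + 4 * s + 6) \<le> 3 * t ^ 3"
        by (simp add: t_def algebra_simps power2_eq_square power3_eq_cube)
      also have "\<dots> \<le> 3 * t ^ Suc s"
        using False s t by (intro mult_left_mono power_increasing) auto
      finally show ?thesis .
    qed (simp add: t_def)
    then show ?thesis
      using u2 l0 by (intro diff_right_mono add_left_mono mult_left_mono) auto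
  qed
  also have "\<dots> < ln 2 * (5 * t ^ Suc s * u * l - 3 / 2)"
  proof -
    \<comment> \<open>This exceeds \<open>5 / 2 * ln 2\<close>, the sum of the leading
      \<open>ln 2\<close> and the rounding loss \<open>3 / 2 * ln 2\<close>.\<close>
    have "2 \<le> s * u"
      using mult_mono[of 1 "real s" 2 u] s u2 by simp
    moreover have "3 * (u * l * t ^ Suc s) \<le> (5 * ln 2) * (u * l * t ^ Suc s)"
      using ln2 u2 l0 t by (intro mult_right_mono) auto
    ultimately show ?thesis
      using ln2 by (simp add: algebra_simps)
  qed
  also have "\<dots> \<le> ln 2 * k"
    using k_gt by (intro mult_left_mono) auto
  also have "\<dots> = ln (real (2 ^ k))"
    by (simp add: ln_realpow)
  finally have "real (2 * w ^ (2 * s) * (2 * m) ^ d) < real (2 ^ k)"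
    using w m0 by (subst (asm) ln_less_cancel_iff) auto
  then show "2 * w ^ (2 * s) * (2 * m) ^ (s * w ^ s) < 2 ^ (m div (2 * w ^ (2 * s)))"
    unfolding d_def k_def by (simp only: of_nat_less_iff)
qed

section \<open>Extremal properties of the graph parameters and the final bound\<close>

lemma card_clique_le:
  assumes "finite V" "clique V E K"
  shows "card K \<le> clique_number V E"
  unfolding clique_number_def
proof (rule Max_ge)
  show "finite {card K |K. clique V E K}"
    by (rule finite_subset[of _ "card ` Pow V"]) (use assms(1) in \<open>auto simp: clique_def\<close>)
qed (use assms(2) in blast)

lemma card_indep_le:
  assumes "finite V" "indep_set V E I"
  shows "card I \<le> indep_number V E"
  unfolding indep_number_def
proof (rule Max_ge)
  show "finite {card I |I. indep_set V E I}"
    by (rule finite_subset[of _ "card ` Pow V"]) (use assms(1) in \<open>auto simp: indep_set_def\<close>)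
qed (use assms(2) in blast)

lemma edge_if_clique_number_ge_2:
  assumes "finite V" "clique_number V E \<ge> 2"
  obtains x y where "x \<in> V" "y \<in> V" "E x y" "E y x"
proof -
  have "clique_number V E \<in> {card K |K. clique V E K}"
    unfolding clique_number_def
  proof (rule Max_in)
    show "finite {card K |K. clique V E K}"
      by (rule finite_subset[of _ "card ` Pow V"]) (use assms(1) in \<open>auto simp: clique_def\<close>)
    have "clique V E {}"
      by (simp add: clique_def)
    then show "{card K |K. clique V E K} \<noteq> {}"
      by blast
  qed
  then obtain K where K: "clique V E K" "card K \<ge> 2"
    using assms(2) by auto
  then obtain K' where "K' \<subseteq> K" "card K' = 2"
    using obtain_subset_with_card_n by metis
  then obtain x y where "x \<in> K" "y \<in> K" "x \<noteq> y"
    by (auto simp: card_2_iff)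
  then show thesis
    using K(1) that[of x y] by (auto simp: clique_def)
qed

lemma hitting_number_le:
  assumes "finite V" "S \<subseteq> V" "\<And>I. max_indep_set V E I \<Longrightarrow> S \<inter> I \<noteq> {}"
  shows "hitting_number V E \<le> card S"
  unfolding hitting_number_def
  by (rule Least_le, intro exI[of _ S] conjI allI impI refl) (use assms in simp_all)

text \<open>With clique number 1 the right-hand side is 0, while a nonempty edgeless graph has
  hitting number 1; hence the lower bound 2 on the clique number.\<close>

theorem theorem1p2:
  fixes V :: "'a set" and E :: "'a \<Rightarrow> 'a \<Rightarrow> bool" and t :: nat
  assumes "graph V E"
    and "t \<ge> 1"
    and "\<not> has_induced_matching V E t"
    and "clique_number V E \<ge> 2"
  shows "real (hitting_number V E)
         \<le> 10 * real t ^ t * real (clique_number V E) ^ (3 * t - 3) * ln (real (clique_number V E))"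
proof -
  define w where "w = clique_number V E"
  have V: "finite V" and E: "\<And>x y. E x y \<Longrightarrow> E y x" "\<And>x. \<not> E x x"
    using assms(1) by (auto simp: graph_def)
  obtain x y where xy: "x \<in> V" "y \<in> V" "E x y" "E y x"
    using edge_if_clique_number_ge_2[OF V assms(4)] .
  obtain s where s: "t = Suc s"
    using assms(2) by (cases t) auto
  \<comment> \<open>A single edge is an induced matching of size 1, so \<open>t = 1\<close> is
    impossible here.\<close>
  have "s \<noteq> 0"
    using assms(3) has_induced_matching_one[of E x y V] xy E(2) unfolding s by metis
  then have s1: "s \<ge> 1"
    by simp
  have w2: "w \<ge> 2"
    using assms(4) by (simp add: w_def)
  have nM: "\<not> has_induced_matching V E (Suc s)"
    using assms(3) s by simp
  let ?b = "10 * real (Suc s) ^ Suc s * real w ^ (3 * s) * ln (real w)"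
  define m where "m = nat \<lfloor>?b\<rfloor>"
  define q where "q = w ^ (2 * s)"
  define k where "k = m div (2 * q)"
  have m: "m > 0" and union_bound: "2 * q * (2 * m) ^ (s * w ^ s) < 2 ^ k"
    using sample_size_suffices[OF w2 s1] unfolding m_def q_def k_def by blast+
  let ?F = "{I. max_indep_set V E I}"
  have "\<exists>S\<subseteq>V. card S \<le> m \<and> (\<forall>I\<in>?F. S \<inter> I \<noteq> {})"
  proof (rule hitting_set_of_compression[OF V, where F = "?F" and d = "s * w ^ s" and q = q and k = k])
    show "V \<noteq> {}"
      using xy by blast
    show "I \<subseteq> V" if "I \<in> ?F" for I
      using that by (simp add: max_indep_set_def indep_set_def)
    show "s * w ^ s \<ge> 1"
      using s1 w2 by simp
    show "\<exists>X\<subseteq>T. card X \<le> s * w ^ s \<and> (\<forall>J\<in>?F. X \<subseteq> J \<longrightarrow> T \<subseteq> J)"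
      if "I \<in> ?F" "T \<subseteq> I" for I T
    proof (rule max_indep_set_compression[where E = E, OF V E nM _ _ _ that])
      show "card K \<le> w" if "clique V E K" for K
        using card_clique_le[OF V that] by (simp add: w_def)
    qed (auto simp: max_indep_set_def intro: card_indep_le[OF V])
    show "card V \<le> q * card I" if "I \<in> ?F" for I
      unfolding q_def
    proof (rule card_le_indep_mult_clique[where E = E, OF V E nM])
      show "card K \<le> w" if "clique V E K" for K
        using card_clique_le[OF V that] by (simp add: w_def)
      show "card J \<le> card I" if "indep_set V E J" for J
        using card_indep_le[OF V that] \<open>I \<in> ?F\<close> by (simp add: max_indep_set_def)
    qed
    show "2 * q * k \<le> m"
      unfolding k_def by (rule times_div_less_eq_dividend)
    \<comment> \<open>A positive integer below \<open>2 ^ k\<close> forces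
      \<open>k \<ge> 1\<close>.\<close>
    have "0 < 2 * q * (2 * m) ^ (s * w ^ s)"
      using m w2 by (simp add: q_def)
    with union_bound have "2 ^ k > (1 :: nat)"
      by linarith
    then show "k \<ge> 1"
      by (cases k) auto
  qed (use m union_bound in auto)
  then obtain S where S: "S \<subseteq> V" "card S \<le> m" "\<And>I. max_indep_set V E I \<Longrightarrow> S \<inter> I \<noteq> {}"
    by blast
  then have "hitting_number V E \<le> m"
    using hitting_number_le[where E = E, OF V S(1)] by fastforce
  moreover have "real m \<le> ?b"
    using w2 unfolding m_def by (intro of_nat_floor) auto
  moreover have "3 * t - 3 = 3 * s"
    by (simp add: s)
  ultimately show ?thesis
    unfolding w_def[symmetric] s by simp
qed

end
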